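(* Let $\Sigma_0$ be a simplicial fan in $\mathbb{R}^n$ such that $\sigma=|\Sigma_0|$ is a full dimensional convex cone. Let $\mathbf w_1,\ldots,\mathbf w_k\in\mathbb{R}^n$ be such that $\mathbf w_i\notin\sigma$ for $i=1,\ldots,k$. Then there exists a simplicial fan $\Sigma$ in $\mathbb{R}^n$ such that (a) $|\Sigma|=\sigma+\langle \mathbf w_1,\ldots,\mathbf w_k\rangle$; (b) $\Sigma(1)=\Sigma_0(1)\cup\{\langle\mathbf w_1\rangle,\ldots,\langle\mathbf w_k\rangle\}$; (c) $\Sigma_0\subseteq\Sigma$.
   Context: A fan is a finite collection of strongly convex polyhedral cones in $\mathbb R^n$, closed under taking faces and such that any two cones intersect in a common face; here cones are not required to be rational. It is simplicial if every cone is generated by linearly independent vectors. $|\Sigma|$ denotes the support (union of the cones) of $\Sigma$, $\Sigma(1)$ its set of rays ($1$-dimensional cones), and $\langle \mathbf w_1,\dots,\mathbf w_k\rangle$ the convex cone of nonnegative real combinations of $\mathbf w_1,\dots,\mathbf w_k$. The sum of two cones is the Minkowski sum. *)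

theory Defs
  imports "HOL-Analysis.Analysis"
begin

text \<open>
  The cone generated by \<open>S\<close>, that is, the set of nonnegative combinations of elements of \<open>S\<close>,
  is the library's \<open>convex_cone hull S\<close>; in particular \<open>convex_cone hull {} = {0}\<close>.
\<close>

lemma convex_cone_hull_finite_eq:
  fixes S :: "'a::real_vector set"
  assumes "finite S"
  shows "convex_cone hull S = {\<Sum>v\<in>S. c v *\<^sub>R v | c. \<forall>v\<in>S. (0::real) \<le> c v}" (is "_ = ?R")
proof (rule hull_unique)
  show "S \<subseteq> ?R"
  proof
    fix x assume x: "x \<in> S"
    have "(\<Sum>v\<in>S. (if v = x then 1 else 0 :: real) *\<^sub>R v) = (\<Sum>v\<in>S. if v = x then v else 0)"
      by (intro sum.cong) auto
    also have "\<dots> = x" using x assms by (simp add: sum.delta)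
    finally have "x = (\<Sum>v\<in>S. (if v = x then 1 else 0 :: real) *\<^sub>R v)" by simp
    then show "x \<in> ?R"
      by (intro CollectI exI[of _ "\<lambda>v. if v = x then 1 else 0"]) auto
  qed
  show "convex_cone ?R"
    unfolding convex_cone_iff
  proof (intro conjI ballI allI impI)
    show "0 \<in> ?R" by (intro CollectI exI[of _ "\<lambda>_. 0"]) auto
  next
    fix x y assume "x \<in> ?R" "y \<in> ?R"
    then obtain c d where "x = (\<Sum>v\<in>S. c v *\<^sub>R v)" "\<forall>v\<in>S. 0 \<le> c v"
      "y = (\<Sum>v\<in>S. d v *\<^sub>R v)" "\<forall>v\<in>S. 0 \<le> d v" by blast
    then show "x + y \<in> ?R"
      by (intro CollectI exI[of _ "\<lambda>v. c v + d v"])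
         (auto simp: scaleR_left_distrib sum.distrib)
  next
    fix x and a :: real assume "x \<in> ?R" "0 \<le> a"
    then obtain c where "x = (\<Sum>v\<in>S. c v *\<^sub>R v)" "\<forall>v\<in>S. 0 \<le> c v" by blast
    with \<open>0 \<le> a\<close> show "a *\<^sub>R x \<in> ?R"
      by (intro CollectI exI[of _ "\<lambda>v. a * c v"]) (auto simp: scaleR_sum_right)
  qed
next
  fix T assume T: "S \<subseteq> T" "convex_cone T"
  show "?R \<subseteq> T"
  proof clarify
    fix c :: "'a \<Rightarrow> real" assume c: "\<forall>v\<in>S. 0 \<le> c v"
    have "F \<subseteq> S \<Longrightarrow> (\<Sum>v\<in>F. c v *\<^sub>R v) \<in> T" if "finite F" for F
      using that
    proof (induction F rule: finite_induct)
      case empty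
      then show ?case using T(2) by (simp add: convex_cone_contains_0)
    next
      case (insert x F)
      then have "c x *\<^sub>R x \<in> T" using T c by (auto intro: convex_cone_scaleR)
      then show ?case using insert T(2) by (simp add: convex_cone_add)
    qed
    then show "(\<Sum>v\<in>S. c v *\<^sub>R v) \<in> T" using assms by simp
  qed
qed

definition polyhedral_cone :: "'a::real_vector set \<Rightarrow> bool" where
  "polyhedral_cone C \<longleftrightarrow> (\<exists>S. finite S \<and> C = convex_cone hull S)"

definition strongly_convex :: "'a::real_vector set \<Rightarrow> bool" where
  "strongly_convex C \<longleftrightarrow> C \<inter> uminus ` C = {0}"

text \<open>
  The empty set is a face of every set in the sense of \<open>face_of\<close>, but it is not a cone;
  it has to be excluded from the closure of a fan under taking faces.
\<close>

definition fan :: "'a::real_vector set set \<Rightarrow> bool" where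
  "fan \<Sigma> \<longleftrightarrow>
     finite \<Sigma> \<and>
     (\<forall>C\<in>\<Sigma>. polyhedral_cone C \<and> strongly_convex C) \<and>
     (\<forall>C\<in>\<Sigma>. \<forall>F. F face_of C \<and> F \<noteq> {} \<longrightarrow> F \<in> \<Sigma>) \<and>
     (\<forall>C\<in>\<Sigma>. \<forall>D\<in>\<Sigma>. (C \<inter> D) face_of C \<and> (C \<inter> D) face_of D)"

definition simplicial_cone :: "'a::real_vector set \<Rightarrow> bool" where
  "simplicial_cone C \<longleftrightarrow> (\<exists>B. finite B \<and> independent B \<and> C = convex_cone hull B)"

definition simplicial_fan :: "'a::real_vector set set \<Rightarrow> bool" where
  "simplicial_fan \<Sigma> \<longleftrightarrow> fan \<Sigma> \<and> (\<forall>C\<in>\<Sigma>. simplicial_cone C)"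

definition support :: "'a set set \<Rightarrow> 'a set" where
  "support \<Sigma> = \<Union>\<Sigma>"

definition rays :: "'a::euclidean_space set set \<Rightarrow> 'a set set" where
  "rays \<Sigma> = {\<rho> \<in> \<Sigma>. dim \<rho> = 1}"

text \<open>
  The dimension of a cone is the dimension of its linear span, which is \<open>dim\<close>.
\<close>

definition full_dimensional :: "'a::euclidean_space set \<Rightarrow> bool" where
  "full_dimensional C \<longleftrightarrow> dim C = DIM('a)"

end

theory Submission
  imports Defs
begin

text \<open>
  The vectors are added one at a time.  One step turns a simplicial fan \<open>\<Sigma>\<close> whose support \<open>S\<close> is a
  convex cone, and a vector \<open>w \<noteq> 0\<close>, into a simplicial fan with support \<open>S + \<langle>w\<rangle>\<close> whose only
  possible new ray is \<open>\<langle>w\<rangle>\<close>, and it discards only cones that contain \<open>w\<close>.  The vectors to be added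
  lie outside the original support, so no cone of the original fan is ever discarded.

  Classically the step has two cases.  For \<open>w \<notin> S\<close>, keep all cones and attach \<open>\<tau> + \<langle>w\<rangle>\<close> for the
  boundary cones \<open>\<tau>\<close> visible from \<open>w\<close> (the placing construction).  For \<open>w \<in> S\<close>, which may happen once
  earlier vectors have enlarged the support, perform the star subdivision at \<open>w\<close>: discard the cones
  containing \<open>w\<close> and attach \<open>\<tau> + \<langle>w\<rangle>\<close> for the faces \<open>\<tau>\<close> of these cones that do not contain \<open>w\<close>.

  Both are instances of one operation.  Let \<open>\<Delta>\<close> be the cones of \<open>\<Sigma>\<close> that avoid \<open>w\<close>, and call
  \<open>\<tau> \<in> \<Delta>\<close> visible if no point \<open>p + t w\<close> with \<open>p \<in> \<tau>\<close> and \<open>t > 0\<close> lies in the support of \<open>\<Delta>\<close>.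
  This is all that is needed for the \<open>\<tau> + \<langle>w\<rangle>\<close> to form a simplicial fan together with \<open>\<Delta>\<close>
  (\<open>simplicial_fan_attach_ray\<close>): it makes \<open>w\<close> independent of the generators of \<open>\<tau>\<close>, and it makes
  the expression \<open>p + t w\<close> of a point unique, so that intersections of new cones reduce to
  intersections in \<open>\<Delta>\<close>.  The two cases differ only in the proof that the visible cones cover what
  is missing: \<open>outer_point_above_visible_cone\<close> uses convexity of \<open>S\<close>,
  \<open>inner_point_above_visible_cone\<close> the coordinates of a simplicial cone.
\<close>

section \<open>Faces of simplicial cones\<close>

lemma convex_cone_hull_singleton: "convex_cone hull {w} = {t *\<^sub>R w | t. 0 \<le> t}"
  by (auto simp: convex_cone_hull_finite_eq)

lemma convex_cone_hull_plus:
  "convex_cone hull (A \<union> B) = convex_cone hull A + convex_cone hull B"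
  unfolding convex_cone_hull_Un set_plus_def by auto

lemma convex_cone_hull_insert:
  "convex_cone hull (insert w A) = convex_cone hull A + convex_cone hull {w}"
  using convex_cone_hull_plus[of A "{w}"] by simp

lemma mem_plus_ray:
  "x \<in> C + convex_cone hull {w} \<longleftrightarrow> (\<exists>p\<in>C. \<exists>t\<ge>0. x = p + t *\<^sub>R w)"
  by (auto simp: set_plus_def convex_cone_hull_singleton)

lemma convex_cone_set_plus: "convex_cone S \<Longrightarrow> convex_cone T \<Longrightarrow> convex_cone (S + T)"
proof -
  have "S + T = (\<Union>x\<in>S. \<Union>y\<in>T. {x + y})" by (auto simp: set_plus_def)
  then show "convex_cone S \<Longrightarrow> convex_cone T \<Longrightarrow> convex_cone (S + T)"
    using convex_cone_sums by metis
qed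

lemma span_convex_cone_hull: "span (convex_cone hull B) = span B"
proof
  have "convex_cone hull B \<subseteq> span B"
    by (intro hull_minimal span_superset convex_cone_span)
  then show "span (convex_cone hull B) \<subseteq> span B" by (simp add: span_minimal)
  show "span B \<subseteq> span (convex_cone hull B)" by (intro span_mono hull_subset)
qed

lemma dim_simplicial_cone:
  fixes B :: "'a::euclidean_space set"
  assumes "independent B"
  shows "dim (convex_cone hull B) = card B"
  by (metis assms dim_span dim_span_eq_card_independent span_convex_cone_hull)

text \<open>
  With respect to a basis of generators, the faces of a simplicial cone are cut out by the
  vanishing of coordinates, so that statements about faces become statements about signs of
  real numbers.
\<close>
lemma mem_convex_cone_hull_iff_representation:
  fixes B :: "'a::real_vector set"
  assumes B: "independent B" "finite B" and A: "A \<subseteq> B"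
  shows "x \<in> convex_cone hull A \<longleftrightarrow>
    x \<in> span B \<and> (\<forall>b\<in>B. 0 \<le> representation B x b) \<and> (\<forall>b\<in>B - A. representation B x b = 0)"
    (is "_ \<longleftrightarrow> ?R")
proof
  have fA: "finite A" using A B finite_subset by auto
  assume "x \<in> convex_cone hull A"
  then obtain c where c: "x = (\<Sum>v\<in>A. c v *\<^sub>R v)" "\<forall>v\<in>A. 0 \<le> c v"
    using convex_cone_hull_finite_eq[OF fA] by auto
  have sp: "v \<in> span B" if "v \<in> A" for v using A that span_base by auto
  have "representation B x b = (\<Sum>v\<in>A. c v * (if b = v then 1 else 0))" for b
  proof -
    have "representation B x b = (\<Sum>v\<in>A. representation B (c v *\<^sub>R v) b)"
      unfolding c(1) using B sp by (subst real_vector.representation_sum) (auto intro: span_scale)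
    also have "\<dots> = (\<Sum>v\<in>A. c v * (if b = v then 1 else 0))"
      using B sp A by (intro sum.cong refl)
        (auto simp: real_vector.representation_scale real_vector.representation_basis subset_iff)
    finally show ?thesis .
  qed
  then have rep: "representation B x b = (if b \<in> A then c b else 0)" for b
    using fA by (simp add: if_distrib sum.delta cong: if_cong)
  have "x \<in> span B" unfolding c(1) using sp by (auto intro!: span_sum span_scale)
  then show ?R using c(2) rep by auto
next
  assume R: ?R
  have fA: "finite A" using A B finite_subset by auto
  have "x = (\<Sum>b\<in>B. representation B x b *\<^sub>R b)"
    using real_vector.sum_representation_eq[of B x B] B R by simp
  also have "\<dots> = (\<Sum>b\<in>A. representation B x b *\<^sub>R b)"
    using A B R by (intro sum.mono_neutral_right) auto
  finally show "x \<in> convex_cone hull A"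
    unfolding convex_cone_hull_finite_eq[OF fA] using R A
    by (intro CollectI exI[of _ "representation B x"]) auto
qed

lemma face_of_simplicial_cone_generated:
  fixes B :: "'a::real_vector set"
  assumes B: "independent B" "finite B" and A: "A \<subseteq> B"
  shows "(convex_cone hull A) face_of (convex_cone hull B)"
  unfolding face_of_def
proof (intro conjI ballI impI)
  show "convex_cone hull A \<subseteq> convex_cone hull B" using A by (rule hull_mono)
  show "convex (convex_cone hull A)" by (rule convex_convex_cone_hull)
  fix x y z
  assume x: "x \<in> convex_cone hull B" and y: "y \<in> convex_cone hull B"
    and z: "z \<in> convex_cone hull A" and "z \<in> open_segment x y"
  then obtain u where u: "0 < u" "u < 1" "z = (1 - u) *\<^sub>R x + u *\<^sub>R y"
    by (auto simp: in_segment)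
  note mem = mem_convex_cone_hull_iff_representation[OF B]
  have x': "x \<in> span B" "\<forall>b\<in>B. 0 \<le> representation B x b"
    and y': "y \<in> span B" "\<forall>b\<in>B. 0 \<le> representation B y b"
    using x y mem[OF order_refl] by auto
  have "representation B x b = 0 \<and> representation B y b = 0" if b: "b \<in> B - A" for b
  proof -
    have "0 = representation B z b" using z b mem[OF A] by auto
    also have "\<dots> = (1 - u) * representation B x b + u * representation B y b"
      unfolding u(3) using B(1) x' y'
      by (simp add: real_vector.representation_add real_vector.representation_scale span_scale)
    finally have *: "(1 - u) * representation B x b + u * representation B y b = 0" by simp
    have "0 \<le> representation B x b" "0 \<le> representation B y b" using x' y' b by auto
    with * u show ?thesis
      by (simp add: add_nonneg_eq_0_iff)
  qed
  then show "x \<in> convex_cone hull A" "y \<in> convex_cone hull A"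
    using x' y' mem[OF A] by auto
qed

lemma convex_cone_face_of:
  assumes "convex_cone C" "F face_of C" "F \<noteq> {}"
  shows "convex_cone F"
  using assms face_of_conic face_of_imp_convex unfolding convex_cone_def by blast

text \<open>
  The midpoint of \<open>2 x\<close> and \<open>2 y\<close> is \<open>x + y\<close>, so the defining property of a face, which speaks of
  segments, becomes a property of sums.
\<close>
lemma face_of_convex_cone_summands:
  assumes C: "convex_cone C" and F: "F face_of C" and x: "x \<in> C" and y: "y \<in> C"
    and xy: "x + y \<in> F"
  shows "x \<in> F" "y \<in> F"
proof -
  have cF: "convex_cone F" using convex_cone_face_of[OF C F] xy by auto
  have "x \<in> F \<and> y \<in> F"
  proof (cases "x = y")
    case True
    have "(1/2) *\<^sub>R (x + y) \<in> F" by (rule convex_cone_scaleR[OF cF _ xy]) simp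
    then show ?thesis using True by (simp add: scaleR_2[symmetric])
  next
    case False
    have "x + y \<in> open_segment (2 *\<^sub>R x) (2 *\<^sub>R y)"
      unfolding in_segment using False by (auto intro!: exI[of _ "1/2"])
    then have "2 *\<^sub>R x \<in> F \<and> 2 *\<^sub>R y \<in> F"
      using face_ofD[OF F] xy x y convex_cone_scaleR[OF C] by (metis zero_le_numeral)
    then have "(1/2) *\<^sub>R (2 *\<^sub>R x) \<in> F \<and> (1/2) *\<^sub>R (2 *\<^sub>R y) \<in> F"
      using convex_cone_scaleR[OF cF] by (metis zero_le_divide_1_iff zero_le_numeral)
    then show ?thesis by simp
  qed
  then show "x \<in> F" "y \<in> F" by auto
qed

lemma face_of_finitely_generated_cone:
  assumes B: "finite B" and F: "F face_of (convex_cone hull B)" "F \<noteq> {}"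
  shows "F = convex_cone hull (B \<inter> F)"
proof
  let ?C = "convex_cone hull B"
  have C: "convex_cone ?C" by (rule convex_cone_convex_cone_hull)
  have cF: "convex_cone F" using convex_cone_face_of[OF C F] .
  show "convex_cone hull (B \<inter> F) \<subseteq> F" by (rule hull_minimal) (use cF in auto)
  show "F \<subseteq> convex_cone hull (B \<inter> F)"
  proof
    fix x assume xF: "x \<in> F"
    then have "x \<in> ?C" using F face_of_imp_subset by blast
    then obtain c where c: "x = (\<Sum>v\<in>B. c v *\<^sub>R v)" "\<forall>v\<in>B. 0 \<le> c v"
      using convex_cone_hull_finite_eq[OF B] by auto
    have inF: "v \<in> F" if v: "v \<in> B" "c v \<noteq> 0" for v
    proof -
      have sum_in: "(\<Sum>v\<in>D. c v *\<^sub>R v) \<in> ?C" if "D \<subseteq> B" for D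
        using subsetD[OF hull_mono[OF that, of convex_cone]] that c(2) finite_subset[OF that B]
        by (simp add: convex_cone_hull_finite_eq[of D]) blast
      have "x = c v *\<^sub>R v + (\<Sum>v\<in>B - {v}. c v *\<^sub>R v)"
        unfolding c(1) using B v by (simp add: sum.remove)
      then have "c v *\<^sub>R v \<in> F"
        using face_of_convex_cone_summands(1)[OF C F(1)] sum_in[of "{v}"] sum_in[of "B - {v}"] v xF
        by auto
      then have "(1 / c v) *\<^sub>R (c v *\<^sub>R v) \<in> F"
        using c(2) v by - (rule convex_cone_scaleR[OF cF], auto)
      then show ?thesis using v by simp
    qed
    have "x = (\<Sum>v\<in>B \<inter> F. c v *\<^sub>R v)"
      unfolding c(1) using B inF by (intro sum.mono_neutral_right) auto
    then show "x \<in> convex_cone hull (B \<inter> F)"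
      using c(2) B by (auto simp: convex_cone_hull_finite_eq)
  qed
qed

lemma simplicial_cone_strongly_convex:
  assumes "simplicial_cone C" shows "strongly_convex C"
proof -
  obtain B where B: "finite B" "independent B" "C = convex_cone hull B"
    using assms by (auto simp: simplicial_cone_def)
  \<comment> \<open>The origin is the face with no generators, and a face contains the summands of its elements.\<close>
  have "{0} face_of C"
    using face_of_simplicial_cone_generated[OF B(2,1), of "{}"] B(3) by simp
  moreover have "convex_cone C" using B by (simp add: convex_cone_convex_cone_hull)
  ultimately have "x = 0" if "x \<in> C" "- x \<in> C" for x
    using face_of_convex_cone_summands(1)[of C "{0}" x "-x"] that by auto
  then show ?thesis
    using \<open>convex_cone C\<close> by (auto simp: strongly_convex_def convex_cone_contains_0)
qed

text \<open>
  The face in question is the one whose relative interior contains \<open>p\<close>: it is generated by the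
  generators at which \<open>p\<close> has a positive coordinate, and every \<open>q\<close> in it is absorbed by a multiple of \<open>p\<close>.
\<close>
lemma ex_face_absorbed_by:
  fixes C :: "'a::real_vector set"
  assumes "simplicial_cone C" "p \<in> C"
  obtains F where "F face_of C" "p \<in> F" "\<And>q. q \<in> F \<Longrightarrow> \<exists>l>0. p - l *\<^sub>R q \<in> F"
proof -
  obtain B where B: "finite B" "independent B" "C = convex_cone hull B"
    using assms by (auto simp: simplicial_cone_def)
  obtain c where c: "p = (\<Sum>v\<in>B. c v *\<^sub>R v)" "\<forall>v\<in>B. 0 \<le> c v"
    using assms(2) convex_cone_hull_finite_eq[OF B(1)] B(3) by auto
  define A where "A = {v\<in>B. 0 < c v}"
  have A: "A \<subseteq> B" "finite A" using B by (auto simp: A_def)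
  have pA: "p = (\<Sum>v\<in>A. c v *\<^sub>R v)"
    unfolding c(1) using B c(2) by (intro sum.mono_neutral_right) (force simp: A_def)+
  show thesis
  proof (rule that)
    show "(convex_cone hull A) face_of C"
      unfolding B(3) using face_of_simplicial_cone_generated[OF B(2,1) A(1)] .
    show "p \<in> convex_cone hull A"
      unfolding convex_cone_hull_finite_eq[OF A(2)] using pA by (auto simp: A_def intro!: exI[of _ c])
    fix q assume "q \<in> convex_cone hull A"
    then obtain d where d: "q = (\<Sum>v\<in>A. d v *\<^sub>R v)" "\<forall>v\<in>A. 0 \<le> d v"
      unfolding convex_cone_hull_finite_eq[OF A(2)] by auto
    \<comment> \<open>Adding 1 to the denominator covers the generators on which \<open>q\<close> has coordinate zero.\<close>
    define l where "l = Min (insert 1 ((\<lambda>v. c v / (d v + 1)) ` A))"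
    have "l > 0"
      unfolding l_def using A(2) d(2) by (subst Min_gr_iff) (auto simp: A_def add_nonneg_pos)
    have le: "l * d v \<le> c v" if v: "v \<in> A" for v
    proof -
      have dv: "0 \<le> d v" using d v by auto
      have "l \<le> c v / (d v + 1)" unfolding l_def using A(2) v by (intro Min_le) auto
      then have "l * (d v + 1) \<le> c v" using dv by (simp add: pos_le_divide_eq)
      then show ?thesis using \<open>l > 0\<close> by (simp add: distrib_left)
    qed
    have "p - l *\<^sub>R q = (\<Sum>v\<in>A. (c v - l * d v) *\<^sub>R v)"
      unfolding pA d(1) by (simp add: scaleR_sum_right sum_subtractf scaleR_diff_left)
    then have "p - l *\<^sub>R q \<in> convex_cone hull A"
      unfolding convex_cone_hull_finite_eq[OF A(2)] using le
      by (auto intro!: exI[of _ "\<lambda>v. c v - l * d v"])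
    then show "\<exists>l>0. p - l *\<^sub>R q \<in> convex_cone hull A" using \<open>l > 0\<close> by blast
  qed
qed

lemma simplicial_fanI:
  assumes "finite \<Sigma>" "\<And>C. C \<in> \<Sigma> \<Longrightarrow> simplicial_cone C"
    and "\<And>C F. C \<in> \<Sigma> \<Longrightarrow> F face_of C \<Longrightarrow> F \<noteq> {} \<Longrightarrow> F \<in> \<Sigma>"
    and "\<And>C D. C \<in> \<Sigma> \<Longrightarrow> D \<in> \<Sigma> \<Longrightarrow> (C \<inter> D) face_of C"
  shows "simplicial_fan \<Sigma>"
proof -
  have "polyhedral_cone C" if "C \<in> \<Sigma>" for C
    using assms(2)[OF that] by (auto simp: simplicial_cone_def polyhedral_cone_def)
  moreover have "strongly_convex C" if "C \<in> \<Sigma>" for C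
    using assms(2)[OF that] by (rule simplicial_cone_strongly_convex)
  moreover have "(C \<inter> D) face_of D" if "C \<in> \<Sigma>" "D \<in> \<Sigma>" for C D
    using assms(4)[OF that(2,1)] by (simp add: Int_commute)
  ultimately show ?thesis
    using assms by (simp add: simplicial_fan_def fan_def)
qed

lemma simplicial_fanD:
  assumes "simplicial_fan \<Sigma>"
  shows "finite \<Sigma>" "C \<in> \<Sigma> \<Longrightarrow> simplicial_cone C"
    and "C \<in> \<Sigma> \<Longrightarrow> F face_of C \<Longrightarrow> F \<noteq> {} \<Longrightarrow> F \<in> \<Sigma>"
    and "C \<in> \<Sigma> \<Longrightarrow> D \<in> \<Sigma> \<Longrightarrow> (C \<inter> D) face_of C"
  using assms by (auto simp: simplicial_fan_def fan_def)

lemma simplicial_coneE: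
  assumes "simplicial_cone C"
  obtains B where "finite B" "independent B" "C = convex_cone hull B"
  using assms by (auto simp: simplicial_cone_def)

lemma simplicial_cone_convex_cone: "simplicial_cone C \<Longrightarrow> convex_cone C"
  by (auto simp: simplicial_cone_def convex_cone_convex_cone_hull)

section \<open>Attaching a ray to the visible part of a fan\<close>

text \<open>
  If the support \<open>S\<close> is convex and full-dimensional and \<open>w\<close> lies outside \<open>S\<close>, these are the cones
  contained in those facets of \<open>S\<close> that separate \<open>w\<close> from \<open>S\<close>.  Speaking of translates instead of
  facets makes sense for every fan.  In particular, if the cones containing a vector \<open>w \<noteq> 0\<close> have been
  removed from a fan, then the faces of the removed cones that do not contain \<open>w\<close> are visible.
\<close>
definition visible :: "'a::real_vector \<Rightarrow> 'a set set \<Rightarrow> 'a set set" where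
  "visible w \<Delta> = {\<tau>\<in>\<Delta>. \<forall>p\<in>\<tau>. \<forall>t>0. p + t *\<^sub>R w \<notin> support \<Delta>}"

definition attach_ray :: "'a::real_vector \<Rightarrow> 'a set set \<Rightarrow> 'a set set" where
  "attach_ray w \<Delta> = \<Delta> \<union> (\<lambda>\<tau>. \<tau> + convex_cone hull {w}) ` visible w \<Delta>"

lemma visible_subset: "\<tau> \<in> visible w \<Delta> \<Longrightarrow> \<tau> \<in> \<Delta>"
  by (simp add: visible_def)

lemma visible_face:
  assumes "simplicial_fan \<Delta>" "\<tau> \<in> visible w \<Delta>" "F face_of \<tau>" "F \<noteq> {}"
  shows "F \<in> visible w \<Delta>"
  using assms simplicial_fanD(3)[OF assms(1), of \<tau> F] face_of_imp_subset[OF assms(3)]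
  by (auto simp: visible_def)

lemma visible_meets_support:
  assumes "\<tau> \<in> visible w \<Delta>" "p \<in> \<tau>" "0 \<le> t" "\<rho> \<in> \<Delta>" "p + t *\<^sub>R w \<in> \<rho>"
  shows "t = 0"
proof (rule ccontr)
  assume "t \<noteq> 0"
  then have "p + t *\<^sub>R w \<notin> support \<Delta>" using assms(1-3) by (simp add: visible_def)
  then show False using assms(4,5) by (auto simp: support_def)
qed

text \<open>
  The difference of two expressions is a translate, in direction \<open>w\<close>, from one visible cone into
  another; visibility forces it to be trivial.
\<close>
lemma visible_inj:
  assumes "\<tau> \<in> visible w \<Delta>" "p \<in> \<tau>" "0 \<le> t" "\<tau>' \<in> visible w \<Delta>" "q \<in> \<tau>'" "0 \<le> s"
    and eq: "p + t *\<^sub>R w = q + s *\<^sub>R w"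
  shows "p = q"
proof (cases "s \<le> t")
  case True
  have "p + (t - s) *\<^sub>R w = q" using eq by (simp add: algebra_simps)
  then show ?thesis
    using visible_meets_support[OF assms(1,2), of "t - s" \<tau>'] True assms(4,5) visible_subset[of \<tau>' w \<Delta>] by simp
next
  case False
  have "q + (s - t) *\<^sub>R w = p" using eq by (simp add: algebra_simps)
  then show ?thesis
    using visible_meets_support[OF assms(4,5), of "s - t" \<tau>] False assms(1,2) visible_subset[of \<tau> w \<Delta>] by simp
qed

text \<open>
  This gives the linear independence that makes the attached cones simplicial: were \<open>w\<close> in the span
  of the cone, a translate by \<open>w\<close> of a point deep inside the cone would still lie in the cone.
\<close>
lemma visible_not_in_span:
  assumes "finite B" "convex_cone hull B \<in> visible w \<Delta>"
  shows "w \<notin> span B"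
proof
  assume "w \<in> span B"
  then obtain c where c: "w = (\<Sum>v\<in>B. c v *\<^sub>R v)"
    using span_finite[OF assms(1)] by auto
  \<comment> \<open>Far out along the sum of the generators, adding \<open>w\<close> keeps all coordinates nonnegative.\<close>
  define M where "M = (\<Sum>v\<in>B. \<bar>c v\<bar>)"
  have M: "\<bar>c v\<bar> \<le> M" if "v \<in> B" for v
    unfolding M_def using assms(1) that by (intro member_le_sum) auto
  have "0 \<le> M" unfolding M_def by (simp add: sum_nonneg)
  have 1: "(\<Sum>v\<in>B. M *\<^sub>R v) \<in> convex_cone hull B"
    unfolding convex_cone_hull_finite_eq[OF assms(1)] using \<open>0 \<le> M\<close>
    by (intro CollectI exI[of _ "\<lambda>_. M"]) simp
  have "(\<Sum>v\<in>B. M *\<^sub>R v) + 1 *\<^sub>R w = (\<Sum>v\<in>B. (M + c v) *\<^sub>R v)"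
    unfolding c by (simp add: scaleR_add_left sum.distrib)
  moreover have "0 \<le> M + c v" if "v \<in> B" for v using M[OF that] by linarith
  ultimately have "(\<Sum>v\<in>B. M *\<^sub>R v) + 1 *\<^sub>R w \<in> convex_cone hull B"
    unfolding convex_cone_hull_finite_eq[OF assms(1)]
    by (intro CollectI exI[of _ "\<lambda>v. M + c v"]) simp
  then show False
    using visible_meets_support[OF assms(2) 1, of 1 "convex_cone hull B"] visible_subset[OF assms(2)]
    by simp
qed

lemma visible_generators:
  assumes "simplicial_fan \<Delta>" "\<tau> \<in> visible w \<Delta>"
  obtains B where "finite B" "independent (insert w B)" "w \<notin> B" "independent B" "\<tau> = convex_cone hull B"
    "\<tau> + convex_cone hull {w} = convex_cone hull (insert w B)"
proof -
  obtain B where B: "finite B" "independent B" "\<tau> = convex_cone hull B"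
    using simplicial_coneE simplicial_fanD(2)[OF assms(1) visible_subset[OF assms(2)]] by metis
  have "w \<notin> span B" using visible_not_in_span B assms(2) by metis
  then show thesis
    using B by - (rule that[OF B(1) _ _ B(2,3)],
      auto simp: independent_insertI convex_cone_hull_insert[of w B] dest: span_base)
qed

lemma face_of_plus_ray:
  assumes "simplicial_fan \<Delta>" "\<tau> \<in> visible w \<Delta>" "F face_of \<tau>" "F \<noteq> {}"
  shows "(F + convex_cone hull {w}) face_of (\<tau> + convex_cone hull {w})"
    and "F face_of (\<tau> + convex_cone hull {w})"
proof -
  obtain B where B: "finite B" "independent (insert w B)" "\<tau> = convex_cone hull B"
      "\<tau> + convex_cone hull {w} = convex_cone hull (insert w B)"
    using visible_generators[OF assms(1,2)] by metis
  have F: "F = convex_cone hull (B \<inter> F)"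
    using face_of_finitely_generated_cone[OF B(1), of F] assms(3,4) B(3) by auto
  note face = face_of_simplicial_cone_generated[OF B(2)]
  have "(convex_cone hull (B \<inter> F)) face_of (convex_cone hull (insert w B))"
    by (rule face) (use B in auto)
  then show "F face_of (\<tau> + convex_cone hull {w})" using F B(4) by simp
  have "(convex_cone hull (insert w (B \<inter> F))) face_of (convex_cone hull (insert w B))"
    by (rule face) (use B in auto)
  then show "(F + convex_cone hull {w}) face_of (\<tau> + convex_cone hull {w})"
    using F B(4) convex_cone_hull_insert[of w "B \<inter> F"] by simp
qed

text \<open>
  Intersections reduce to intersections in \<open>\<Delta>\<close>: an attached cone meets an old cone only in its
  base, and two attached cones meet in the attached cone over the intersection of their bases.
\<close>
proposition simplicial_fan_attach_ray:
  assumes \<Delta>: "simplicial_fan \<Delta>"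
  shows "simplicial_fan (attach_ray w \<Delta>)"
proof (rule simplicial_fanI)
  let ?R = "convex_cone hull {w}"
  show "finite (attach_ray w \<Delta>)"
    using simplicial_fanD(1)[OF \<Delta>] by (simp add: attach_ray_def visible_def)
  show "simplicial_cone C" if "C \<in> attach_ray w \<Delta>" for C
  proof -
    have "simplicial_cone (\<tau> + ?R)" if \<tau>: "\<tau> \<in> visible w \<Delta>" for \<tau>
      using visible_generators[OF \<Delta> \<tau>] unfolding simplicial_cone_def by (metis finite_insert)
    with that show ?thesis using simplicial_fanD(2)[OF \<Delta>] by (auto simp: attach_ray_def)
  qed
  show "F \<in> attach_ray w \<Delta>" if C: "C \<in> attach_ray w \<Delta>" and "F face_of C" "F \<noteq> {}" for C F
  proof (cases "C \<in> \<Delta>")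
    case True
    then show ?thesis using that simplicial_fanD(3)[OF \<Delta>] by (auto simp: attach_ray_def)
  next
    case False
    then obtain \<tau> where \<tau>: "\<tau> \<in> visible w \<Delta>" "C = \<tau> + ?R"
      using C by (auto simp: attach_ray_def)
    obtain B where B: "finite B" "independent (insert w B)" "w \<notin> B" "independent B"
        "\<tau> = convex_cone hull B" "C = convex_cone hull (insert w B)"
      using visible_generators[OF \<Delta> \<tau>(1)] \<tau>(2) by metis
    have F: "F = convex_cone hull (insert w B \<inter> F)"
      using face_of_finitely_generated_cone[of "insert w B" F] that B by auto
    define A where "A = B \<inter> F"
    have "(convex_cone hull A) face_of \<tau>"
      unfolding B(5) A_def by (rule face_of_simplicial_cone_generated) (use B in auto)
    then have vis: "convex_cone hull A \<in> visible w \<Delta>"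
      using visible_face[OF \<Delta> \<tau>(1)] convex_cone_hull_nonempty by auto
    show ?thesis
    proof (cases "w \<in> F")
      case True
      then have "F = convex_cone hull (insert w A)" using F by (simp add: A_def)
      then have "F = convex_cone hull A + ?R" by (simp add: convex_cone_hull_insert[of w A])
      then show ?thesis using vis by (auto simp: attach_ray_def)
    next
      case False
      then have "F = convex_cone hull A" using F by (simp add: A_def)
      then show ?thesis using vis visible_subset by (auto simp: attach_ray_def)
    qed
  qed
  have old_new: "(\<tau> + ?R) \<inter> \<rho> = \<tau> \<inter> \<rho>" if "\<tau> \<in> visible w \<Delta>" "\<rho> \<in> \<Delta>" for \<tau> \<rho>
  proof (intro equalityI subsetI)
    fix x assume "x \<in> (\<tau> + ?R) \<inter> \<rho>"
    then obtain p t where "p \<in> \<tau>" "0 \<le> t" "x = p + t *\<^sub>R w" "x \<in> \<rho>"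
      by (auto simp: mem_plus_ray)
    then show "x \<in> \<tau> \<inter> \<rho>" using visible_meets_support[OF that(1) _ _ that(2), of p t] by auto
  next
    fix x assume "x \<in> \<tau> \<inter> \<rho>"
    then show "x \<in> (\<tau> + ?R) \<inter> \<rho>"
      by (auto simp: mem_plus_ray intro!: bexI[of _ x] exI[of _ "0::real"])
  qed
  have new_new: "(\<tau> + ?R) \<inter> (\<tau>' + ?R) = (\<tau> \<inter> \<tau>') + ?R"
    if "\<tau> \<in> visible w \<Delta>" "\<tau>' \<in> visible w \<Delta>" for \<tau> \<tau>'
  proof (intro equalityI subsetI)
    fix x assume "x \<in> (\<tau> + ?R) \<inter> (\<tau>' + ?R)"
    then obtain p t q s where *: "p \<in> \<tau>" "0 \<le> t" "x = p + t *\<^sub>R w"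
        "q \<in> \<tau>'" "0 \<le> s" "x = q + s *\<^sub>R w"
      by (auto simp: mem_plus_ray)
    then have "p = q" by (intro visible_inj[OF that(1) *(1,2) that(2) *(4,5)]) simp
    then show "x \<in> (\<tau> \<inter> \<tau>') + ?R" using * unfolding mem_plus_ray by blast
  qed (auto simp: mem_plus_ray)
  have ne: "C \<inter> D \<noteq> {}" if "C \<in> \<Delta>" "D \<in> \<Delta>" for C D
    using that simplicial_fanD(2)[OF \<Delta>] simplicial_cone_convex_cone convex_cone_contains_0 by blast
  note meet = simplicial_fanD(4)[OF \<Delta>]
  show "(C \<inter> D) face_of C" if "C \<in> attach_ray w \<Delta>" "D \<in> attach_ray w \<Delta>" for C D
  proof -
    consider "C \<in> \<Delta>" "D \<in> \<Delta>"
      | \<tau> where "C \<in> \<Delta>" "\<tau> \<in> visible w \<Delta>" "D = \<tau> + ?R"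
      | \<tau> where "\<tau> \<in> visible w \<Delta>" "C = \<tau> + ?R" "D \<in> \<Delta>"
      | \<tau> \<tau>' where "\<tau> \<in> visible w \<Delta>" "C = \<tau> + ?R" "\<tau>' \<in> visible w \<Delta>" "D = \<tau>' + ?R"
      using \<open>C \<in> attach_ray w \<Delta>\<close> \<open>D \<in> attach_ray w \<Delta>\<close> by (auto simp: attach_ray_def)
    then show ?thesis
    proof cases
      case 1 then show ?thesis by (rule meet)
    next
      case 2
      then show ?thesis
        using old_new[of \<tau> C] meet[of C \<tau>] visible_subset by (metis Int_commute)
    next
      case 3
      then show ?thesis
        using old_new[of \<tau> D] face_of_plus_ray(2)[OF \<Delta>, of \<tau> w "\<tau> \<inter> D"] meet[of \<tau> D] ne[of \<tau> D]
          visible_subset[of \<tau> w \<Delta>] by simp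
    next
      case 4
      then show ?thesis
        using new_new[of \<tau> \<tau>'] face_of_plus_ray(1)[OF \<Delta>, of \<tau> w "\<tau> \<inter> \<tau>'"] meet[of \<tau> \<tau>']
          ne[of \<tau> \<tau>'] visible_subset[of _ w \<Delta>] by simp
    qed
  qed
qed

section \<open>Adding one generator\<close>

definition avoiding :: "'a \<Rightarrow> 'a set set \<Rightarrow> 'a set set" where
  "avoiding w \<Sigma> = {\<tau>\<in>\<Sigma>. w \<notin> \<tau>}"

lemma simplicial_fan_avoiding:
  assumes "simplicial_fan \<Sigma>"
  shows "simplicial_fan (avoiding w \<Sigma>)"
proof (rule simplicial_fanI)
  show "F \<in> avoiding w \<Sigma>" if "C \<in> avoiding w \<Sigma>" "F face_of C" "F \<noteq> {}" for C F
    using that simplicial_fanD(3)[OF assms, of C F] face_of_imp_subset[of F C]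
    by (auto simp: avoiding_def)
qed (use simplicial_fanD[OF assms] in \<open>auto simp: avoiding_def\<close>)

lemma closed_support:
  fixes \<Sigma> :: "'a::euclidean_space set set"
  assumes "simplicial_fan \<Sigma>" shows "closed (support \<Sigma>)"
  unfolding support_def
proof (rule closed_Union)
  show "finite \<Sigma>" using simplicial_fanD(1)[OF assms] .
  show "\<forall>C\<in>\<Sigma>. closed C"
    using simplicial_fanD(2)[OF assms] closed_convex_cone_hull by (auto simp: simplicial_cone_def)
qed

lemma zero_cone_in_fan:
  assumes "simplicial_fan \<Sigma>" "C \<in> \<Sigma>" shows "{0} \<in> \<Sigma>"
proof -
  obtain B where B: "finite B" "independent B" "C = convex_cone hull B"
    using simplicial_fanD(2)[OF assms] by (rule simplicial_coneE)
  then have "{0} face_of C" using face_of_simplicial_cone_generated[of B "{}"] by simp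
  then show ?thesis using simplicial_fanD(3)[OF assms] by blast
qed

text \<open>
  Walking from \<open>x\<close> in direction \<open>-w\<close>, let \<open>p\<close> be the first point met in the support.  By convexity
  the ray from \<open>p\<close> in direction \<open>w\<close> never meets the support again, and by convexity once more
  this property passes from \<open>p\<close> to all points of the face having \<open>p\<close> in its relative interior.
\<close>
lemma outer_point_above_visible_cone:
  fixes w :: "'a::euclidean_space"
  assumes \<Sigma>: "simplicial_fan \<Sigma>" and cone: "convex_cone (support \<Sigma>)"
    and x: "x \<in> support \<Sigma> + convex_cone hull {w}" "x \<notin> support \<Sigma>"
  shows "\<exists>\<tau>\<in>visible w \<Sigma>. x \<in> \<tau> + convex_cone hull {w}"
proof -
  let ?S = "support \<Sigma>"
  define R where "R = {r. 0 \<le> r \<and> x - r *\<^sub>R w \<in> ?S}"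
  obtain s t where st: "s \<in> ?S" "0 \<le> t" "x = s + t *\<^sub>R w" using x by (auto simp: mem_plus_ray)
  have "R = {0..} \<inter> (\<lambda>r. x - r *\<^sub>R w) -` ?S" by (auto simp: R_def)
  moreover have "closed ((\<lambda>r. x - r *\<^sub>R w) -` ?S)"
    by (intro closed_vimage closed_support[OF \<Sigma>] continuous_intros)
  ultimately have "closed R" by (simp add: closed_Int)
  moreover have "t \<in> R" using st by (simp add: R_def)
  moreover have bdd: "bdd_below R" by (rule bdd_belowI[of _ 0]) (simp add: R_def)
  ultimately have "Inf R \<in> R" by (intro closed_contains_Inf) auto
  define r where "r = Inf R"
  have r: "0 \<le> r" "x - r *\<^sub>R w \<in> ?S" using \<open>Inf R \<in> R\<close> by (auto simp: R_def r_def)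
  have least: "r \<le> r'" if "0 \<le> r'" "x - r' *\<^sub>R w \<in> ?S" for r'
    unfolding r_def using bdd that by (intro cInf_lower) (auto simp: R_def)
  have "r \<noteq> 0" using r x by auto
  with r have "0 < r" by simp
  define p where "p = x - r *\<^sub>R w"
  have xp: "x = p + r *\<^sub>R w" by (simp add: p_def)
  have beyond: "p + e *\<^sub>R w \<notin> ?S" if "0 < e" for e
  proof
    assume in_S: "p + e *\<^sub>R w \<in> ?S"
    show False
    proof (cases "e \<le> r")
      case True
      have "x - (r - e) *\<^sub>R w \<in> ?S" using in_S by (simp add: p_def algebra_simps)
      then show False using least[of "r - e"] True that by simp
    next
      case False
      \<comment> \<open>Here \<open>x\<close> lies on the segment between two points of the support.\<close>
      have "(1 - r / e) *\<^sub>R p + (r / e) *\<^sub>R (p + e *\<^sub>R w) \<in> ?S"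
      proof (rule convex_cone_add[OF cone])
        show "(1 - r / e) *\<^sub>R p \<in> ?S"
          by (rule convex_cone_scaleR[OF cone]) (use r False that in \<open>auto simp: p_def\<close>)
        show "(r / e) *\<^sub>R (p + e *\<^sub>R w) \<in> ?S"
          by (rule convex_cone_scaleR[OF cone _ in_S]) (use r that in auto)
      qed
      moreover have "(1 - r / e) *\<^sub>R p + (r / e) *\<^sub>R (p + e *\<^sub>R w) = x"
        using that by (simp add: xp algebra_simps)
      ultimately show False using x by simp
    qed
  qed
  obtain C where C: "C \<in> \<Sigma>" "p \<in> C" using r by (auto simp: support_def p_def)
  obtain F where F: "F face_of C" "p \<in> F" "\<And>q. q \<in> F \<Longrightarrow> \<exists>l>0. p - l *\<^sub>R q \<in> F"
    using ex_face_absorbed_by[OF simplicial_fanD(2)[OF \<Sigma> C(1)] C(2)] by blast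
  have F\<Sigma>: "F \<in> \<Sigma>" using simplicial_fanD(3)[OF \<Sigma> C(1) F(1)] F(2) by auto
  have "q + t *\<^sub>R w \<notin> ?S" if q: "q \<in> F" "0 < t" for q t
  proof
    assume in_S: "q + t *\<^sub>R w \<in> ?S"
    obtain l where l: "0 < l" "p - l *\<^sub>R q \<in> F" using F(3) q by blast
    have "p - l *\<^sub>R q \<in> ?S" using l F\<Sigma> by (auto simp: support_def)
    then have "(p - l *\<^sub>R q) + l *\<^sub>R (q + t *\<^sub>R w) \<in> ?S"
      using l by (intro convex_cone_add[OF cone] convex_cone_scaleR[OF cone _ in_S]) auto
    then have "p + (l * t) *\<^sub>R w \<in> ?S" by (simp add: algebra_simps)
    then show False using beyond[of "l * t"] l q by simp
  qed
  then have "F \<in> visible w \<Sigma>" using F\<Sigma> by (simp add: visible_def)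
  then show ?thesis using F(2) xp r(1) by (auto simp: mem_plus_ray)
qed

text \<open>
  Inside a cone \<open>\<rho>\<close> containing \<open>w\<close>, subtract from \<open>x\<close> the largest multiple of \<open>w\<close> that keeps all
  coordinates nonnegative: some coordinate that is positive for \<open>w\<close> becomes zero, and the facet on
  which it vanishes does not contain \<open>w\<close>.  That facet is visible because a cone of the fan that
  meets the relevant translate contains, together with a sum in \<open>\<rho>\<close>, its summand \<open>w\<close>.
\<close>
lemma inner_point_above_visible_cone:
  fixes w :: "'a::real_vector"
  assumes \<Sigma>: "simplicial_fan \<Sigma>" and "w \<noteq> 0" and \<rho>: "\<rho> \<in> \<Sigma>" "w \<in> \<rho>" "x \<in> \<rho>"
  shows "\<exists>\<tau>\<in>visible w (avoiding w \<Sigma>). x \<in> \<tau> + convex_cone hull {w}"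
proof -
  obtain B where B: "finite B" "independent B" "\<rho> = convex_cone hull B"
    using simplicial_fanD(2)[OF \<Sigma> \<rho>(1)] by (rule simplicial_coneE)
  note mem = mem_convex_cone_hull_iff_representation[OF B(2,1)]
  define f g where "f = representation B x" and "g = representation B w"
  have f: "x \<in> span B" "\<And>b. b \<in> B \<Longrightarrow> 0 \<le> f b" and g: "w \<in> span B" "\<And>b. b \<in> B \<Longrightarrow> 0 \<le> g b"
    using \<rho> B(3) mem[OF order_refl] by (auto simp: f_def g_def)
  define P where "P = {b\<in>B. 0 < g b}"
  have "P \<noteq> {}"
  proof
    assume "P = {}"
    then have "w \<in> convex_cone hull {}"
      using g mem[of "{}" w] by (force simp: P_def g_def)
    then show False using \<open>w \<noteq> 0\<close> by simp
  qed
  moreover have "finite P" using B by (simp add: P_def)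
  ultimately obtain b0 where b0: "b0 \<in> P" "\<And>b. b \<in> P \<Longrightarrow> f b0 / g b0 \<le> f b / g b"
    using arg_min_if_finite[of P "\<lambda>b. f b / g b"] by (metis linorder_not_less)
  define r where "r = f b0 / g b0"
  have b0': "b0 \<in> B" "0 < g b0" using b0 by (auto simp: P_def)
  have "0 \<le> r" using b0' f by (simp add: r_def)
  define A where "A = B - {b0}"
  define \<tau> where "\<tau> = convex_cone hull A"
  have rep: "representation B (x - r *\<^sub>R w) b = f b - r * g b" for b
    using B f g by (simp add: real_vector.representation_diff real_vector.representation_scale
        span_scale f_def g_def)
  have "0 \<le> f b - r * g b" if b: "b \<in> B" for b
  proof (cases "b \<in> P")
    case True
    then have "r \<le> f b / g b" "0 < g b" using b0(2) by (auto simp: r_def P_def)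
    then show ?thesis by (simp add: pos_le_divide_eq)
  next
    case False
    then have "g b = 0" using g(2)[OF b] b by (auto simp: P_def)
    then show ?thesis using f b by simp
  qed
  moreover have "f b0 - r * g b0 = 0" using b0' by (simp add: r_def)
  ultimately have p: "x - r *\<^sub>R w \<in> \<tau>"
    unfolding \<tau>_def using f g b0' rep by (subst mem) (auto simp: A_def span_diff span_scale)
  have "w \<notin> \<tau>"
    unfolding \<tau>_def using b0' by (subst mem) (auto simp: A_def g_def)
  have face: "\<tau> face_of \<rho>"
    unfolding \<tau>_def B(3) A_def by (rule face_of_simplicial_cone_generated) (use B in auto)
  then have "\<tau> \<in> avoiding w \<Sigma>"
    using simplicial_fanD(3)[OF \<Sigma> \<rho>(1)] p \<open>w \<notin> \<tau>\<close> by (auto simp: avoiding_def)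
  moreover have "q + t *\<^sub>R w \<notin> support (avoiding w \<Sigma>)" if q: "q \<in> \<tau>" "0 < t" for q t
  proof
    assume "q + t *\<^sub>R w \<in> support (avoiding w \<Sigma>)"
    then obtain C where C: "C \<in> \<Sigma>" "w \<notin> C" "q + t *\<^sub>R w \<in> C"
      by (auto simp: support_def avoiding_def)
    have cone: "convex_cone \<rho>" "convex_cone C"
      using simplicial_fanD(2)[OF \<Sigma>] \<rho> C simplicial_cone_convex_cone by auto
    have in_\<rho>: "q \<in> \<rho>" "t *\<^sub>R w \<in> \<rho>"
      using q face face_of_imp_subset \<rho> convex_cone_scaleR[OF cone(1)] by auto
    then have "q + t *\<^sub>R w \<in> \<rho> \<inter> C" using C convex_cone_add[OF cone(1)] by auto
    then have "t *\<^sub>R w \<in> C"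
      using face_of_convex_cone_summands(2)[OF cone(1) simplicial_fanD(4)[OF \<Sigma> \<rho>(1) C(1)] in_\<rho>]
      by auto
    then have "(1 / t) *\<^sub>R t *\<^sub>R w \<in> C" by (rule convex_cone_scaleR[OF cone(2), rotated]) (use q in auto)
    then show False using q C by simp
  qed
  ultimately have "\<tau> \<in> visible w (avoiding w \<Sigma>)" by (simp add: visible_def)
  moreover have "x = (x - r *\<^sub>R w) + r *\<^sub>R w" by simp
  ultimately show ?thesis using p \<open>0 \<le> r\<close> unfolding mem_plus_ray by blast
qed

text \<open>
  A point of \<open>S + \<langle>w\<rangle>\<close> lies in a cone that avoids \<open>w\<close>, in a cone that contains \<open>w\<close>, or outside \<open>S\<close>.
  The last case forces \<open>w \<notin> S\<close>, so that no cone has been discarded.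
\<close>
lemma support_attach_ray_avoiding:
  fixes w :: "'a::euclidean_space"
  assumes \<Sigma>: "simplicial_fan \<Sigma>" and cone: "convex_cone (support \<Sigma>)" and "w \<noteq> 0"
  shows "support (attach_ray w (avoiding w \<Sigma>)) = support \<Sigma> + convex_cone hull {w}" (is "?L = ?R")
proof
  have "C + convex_cone hull {w} \<subseteq> ?R" if "C \<in> \<Sigma>" for C
    using that by (intro set_plus_mono2) (auto simp: support_def)
  moreover have "C \<subseteq> ?R" if "C \<in> \<Sigma>" for C
    using that by (fastforce simp: mem_plus_ray support_def intro: exI[of _ "0::real"])
  ultimately show "?L \<subseteq> ?R"
    by (fastforce simp: support_def attach_ray_def avoiding_def dest: visible_subset)
  have new: "x \<in> ?L" if "\<tau> \<in> visible w (avoiding w \<Sigma>)" "x \<in> \<tau> + convex_cone hull {w}" for x \<tau>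
    using that by (auto simp: support_def attach_ray_def)
  show "?R \<subseteq> ?L"
  proof
    fix x assume x: "x \<in> ?R"
    consider "x \<in> support (avoiding w \<Sigma>)" | \<rho> where "\<rho> \<in> \<Sigma>" "w \<in> \<rho>" "x \<in> \<rho>" | "x \<notin> support \<Sigma>"
      by (auto simp: support_def avoiding_def)
    then show "x \<in> ?L"
    proof cases
      case 1
      then show ?thesis by (auto simp: support_def attach_ray_def)
    next
      case 2
      then show ?thesis using inner_point_above_visible_cone[OF \<Sigma> \<open>w \<noteq> 0\<close>] new by blast
    next
      case 3
      have "w \<notin> support \<Sigma>"
      proof
        assume "w \<in> support \<Sigma>"
        then have "?R \<subseteq> support \<Sigma>"
          using cone by (auto simp: mem_plus_ray intro!: convex_cone_add convex_cone_scaleR)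
        then show False using x 3 by auto
      qed
      then have "avoiding w \<Sigma> = \<Sigma>" by (auto simp: avoiding_def support_def)
      then show ?thesis using outer_point_above_visible_cone[OF \<Sigma> cone x 3] new by auto
    qed
  qed
qed

lemma ray_through:
  assumes "simplicial_cone C" "dim C = 1" "w \<in> C" "w \<noteq> 0"
  shows "C = convex_cone hull {w :: 'a::euclidean_space}"
proof -
  obtain B where B: "finite B" "independent B" "C = convex_cone hull B"
    using assms(1) by (rule simplicial_coneE)
  then have "card B = 1" using assms(2) dim_simplicial_cone by metis
  then obtain b where b: "C = convex_cone hull {b}" using B(3) card_1_singletonE by metis
  then obtain t where t: "0 \<le> t" "w = t *\<^sub>R b" using assms(3) by (auto simp: convex_cone_hull_singleton)
  then have "0 < t" using assms(4) by (cases "t = 0") auto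
  show ?thesis
    unfolding b
  proof (rule antisym; rule hull_minimal)
    have "b = (1 / t) *\<^sub>R w" using t \<open>0 < t\<close> by simp
    then show "{b} \<subseteq> convex_cone hull {w}"
      using \<open>0 < t\<close> by (auto simp: convex_cone_hull_singleton intro!: exI[of _ "1 / t"])
    show "{w} \<subseteq> convex_cone hull {b}" using t by (auto simp: convex_cone_hull_singleton)
  qed (rule convex_cone_convex_cone_hull)+
qed

text \<open>
  The only ray that can be discarded is \<open>\<langle>w\<rangle>\<close> itself, and it returns as the cone attached over the
  origin.  An attached cone has one dimension more than its base, so it contributes no other ray.
\<close>
lemma rays_attach_ray_avoiding:
  fixes w :: "'a::euclidean_space"
  assumes \<Sigma>: "simplicial_fan \<Sigma>" "\<Sigma> \<noteq> {}" and "w \<noteq> 0"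
  shows "rays (attach_ray w (avoiding w \<Sigma>)) = rays \<Sigma> \<union> {convex_cone hull {w}}" (is "?L = ?R")
proof -
  let ?\<Delta> = "avoiding w \<Sigma>" and ?r = "convex_cone hull {w}"
  note \<Delta> = simplicial_fan_avoiding[OF \<Sigma>(1), of w]
  have zero: "{0} \<in> \<Sigma>" using zero_cone_in_fan[OF \<Sigma>(1)] \<Sigma>(2) by blast
  have "0 + t *\<^sub>R w \<notin> support ?\<Delta>" if "0 < t" for t
  proof
    assume "0 + t *\<^sub>R w \<in> support ?\<Delta>"
    then obtain C where C: "C \<in> \<Sigma>" "w \<notin> C" "t *\<^sub>R w \<in> C" by (auto simp: support_def avoiding_def)
    have "convex_cone C" using simplicial_fanD(2)[OF \<Sigma>(1) C(1)] simplicial_cone_convex_cone by auto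
    then have "(1 / t) *\<^sub>R t *\<^sub>R w \<in> C" using C that by - (rule convex_cone_scaleR, auto)
    then show False using that C by simp
  qed
  then have "{0} \<in> visible w ?\<Delta>" using zero \<open>w \<noteq> 0\<close> by (auto simp: visible_def avoiding_def)
  then have "{0} + ?r \<in> attach_ray w ?\<Delta>" unfolding attach_ray_def by blast
  moreover have "{0} + ?r = ?r" by (auto simp: set_plus_def)
  moreover have "dim ?r = 1" using \<open>w \<noteq> 0\<close> by (subst dim_simplicial_cone) auto
  ultimately have r: "?r \<in> ?L" by (simp add: rays_def)
  have old: "C \<in> ?L" if "C \<in> rays \<Sigma>" for C
  proof (cases "w \<in> C")
    case True
    then have "C = ?r"
      using that \<open>w \<noteq> 0\<close> simplicial_fanD(2)[OF \<Sigma>(1)] by (intro ray_through) (auto simp: rays_def)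
    then show ?thesis using r by simp
  next
    case False
    then show ?thesis using that by (auto simp: rays_def attach_ray_def avoiding_def)
  qed
  have new: "\<tau> + ?r = ?r" if \<tau>: "\<tau> \<in> visible w ?\<Delta>" and dim: "dim (\<tau> + ?r) = 1" for \<tau>
  proof -
    obtain B where B: "finite B" "independent (insert w B)" "w \<notin> B"
        "\<tau> + ?r = convex_cone hull (insert w B)"
      using visible_generators[OF \<Delta> \<tau>] by metis
    then have "card (insert w B) = 1" using dim dim_simplicial_cone by metis
    then have "B = {}" using B by simp
    then show ?thesis using B(4) by simp
  qed
  show ?thesis
  proof
    show "?L \<subseteq> ?R" using new by (auto simp: rays_def attach_ray_def avoiding_def)
    show "?R \<subseteq> ?L" using r old by auto
  qed
qed

theorem lemma2p11:
  fixes \<Sigma>\<^sub>0 :: "(real ^ 'n) set set"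
    and \<sigma> :: "(real ^ 'n) set"
    and k :: nat
    and w :: "nat \<Rightarrow> real ^ 'n"
  assumes "simplicial_fan \<Sigma>\<^sub>0"
    and "\<sigma> = support \<Sigma>\<^sub>0"
    and "convex_cone \<sigma>"
    and "full_dimensional \<sigma>"
    and "\<And>i. i \<in> {1..k} \<Longrightarrow> w i \<notin> \<sigma>"
  shows "\<exists>\<Sigma> :: (real ^ 'n) set set.
           simplicial_fan \<Sigma> \<and>
           support \<Sigma> = \<sigma> + convex_cone hull (w ` {1..k}) \<and>
           rays \<Sigma> = rays \<Sigma>\<^sub>0 \<union> {convex_cone hull {w i} | i. i \<in> {1..k}} \<and>
           \<Sigma>\<^sub>0 \<subseteq> \<Sigma>"
  using assms(5)
proof (induction k)
  case 0
  have "\<sigma> + {0} = \<sigma>" by (auto simp: set_plus_def)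
  then show ?case using assms(1,2) by (intro exI[of _ \<Sigma>\<^sub>0]) auto
next
  case (Suc k)
  let ?v = "w (Suc k)" and ?H = "convex_cone hull (w ` {1..k})"
  obtain \<Sigma> where \<Sigma>: "simplicial_fan \<Sigma>" "support \<Sigma> = \<sigma> + ?H"
      "rays \<Sigma> = rays \<Sigma>\<^sub>0 \<union> {convex_cone hull {w i} | i. i \<in> {1..k}}" "\<Sigma>\<^sub>0 \<subseteq> \<Sigma>"
    using Suc by auto
  have cone: "convex_cone (support \<Sigma>)"
    unfolding \<Sigma>(2) by (intro convex_cone_set_plus assms(3) convex_cone_convex_cone_hull)
  have v: "?v \<notin> \<sigma>" using Suc.prems by simp
  then have "?v \<noteq> 0" using convex_cone_contains_0[OF assms(3)] by metis
  have "\<Sigma> \<noteq> {}" using convex_cone_nonempty[OF cone] by (auto simp: support_def)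
  have idx: "{1..Suc k} = insert (Suc k) {1..k}" by auto
  define \<Sigma>' where "\<Sigma>' = attach_ray ?v (avoiding ?v \<Sigma>)"
  have "simplicial_fan \<Sigma>'"
    unfolding \<Sigma>'_def by (intro simplicial_fan_attach_ray simplicial_fan_avoiding \<Sigma>(1))
  moreover have "support \<Sigma>' = \<sigma> + convex_cone hull (w ` {1..Suc k})"
    unfolding \<Sigma>'_def support_attach_ray_avoiding[OF \<Sigma>(1) cone \<open>?v \<noteq> 0\<close>] \<Sigma>(2) idx image_insert
    unfolding convex_cone_hull_insert[of ?v "w ` {1..k}"] by (simp only: add.assoc)
  moreover have "rays \<Sigma>' = rays \<Sigma>\<^sub>0 \<union> {convex_cone hull {w i} | i. i \<in> {1..Suc k}}"
    unfolding \<Sigma>'_def rays_attach_ray_avoiding[OF \<Sigma>(1) \<open>\<Sigma> \<noteq> {}\<close> \<open>?v \<noteq> 0\<close>] \<Sigma>(3) idx by auto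
  moreover have "\<Sigma>\<^sub>0 \<subseteq> \<Sigma>'"
    using v \<Sigma>(4) assms(2) by (auto simp: \<Sigma>'_def attach_ray_def avoiding_def support_def)
  ultimately show ?case by blast
qed

end
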